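(* Let $\delta$ be a log-distance on the set of branches over $K$. Let $C$ be a reduced curve with $r>1$ branches $C_1,\ldots,C_r$, and let $\mathcal{B}$ be a non-empty family of branches such that for every branch $D$ there exists $W_0\in\mathcal{B}$ with $\delta(D,\mathcal{B})=\delta(D,W_0)$. Then $$\delta(C,\mathcal{B})=\inf\Bigl\{\inf_{i}\{\delta(C_i,\mathcal{B})\},\ \inf_{i,j}\{\delta(C_i,C_j)\}\Bigr\}.$$ Moreover, there exists $i_0\in\{1,\ldots,r\}$ such that if a branch $W\in\mathcal{B}$ has maximal $\delta$-contact with $C_{i_0}$, then $W$ has maximal $\delta$-contact with $C$.
   Context: $K$ is an algebraically closed field of arbitrary characteristic. An algebroid curve $C:\{f=0\}$ is the ideal of $K[[x,y]]$ generated by a nonzero power series $f$ without constant term. $C$ is reduced if $f$ has no multiple factors; $C$ is a branch if $f$ is irreducible. The branches (irreducible components) of a reduced curve $C:\{f=0\}$ are the curves defined by the irreducible factors of $f$. A log-distance $\delta$ associates with any two branches $C,D$ an element $\delta(C,D)\in\mathbb{R}_+\cup\{+\infty\}$ such that for all branches $C,D,E$: ($\delta_1$) $\delta(C,D)=\infty$ if and only if $C=D$; ($\delta_2$) $\delta(C,D)=\delta(D,C)$; ($\delta_3$) $\delta(C,D)\ge\inf\{\delta(C,E),\delta(E,D)\}$. If $C$ and $D$ are reduced curves with branches $C_i$ and $D_j$, put $\delta(C,D):=\inf_{i,j}\{\delta(C_i,D_j)\}$. For a reduced curve $C$ and a non-empty family of branches $\mathcal{B}$, put $\delta(C,\mathcal{B}):=\sup\{\delta(C,W):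 W\in\mathcal{B}\}$. A branch $W\in\mathcal{B}$ has maximal $\delta$-contact with $C$ if $\delta(C,W)=\delta(C,\mathcal{B})$. *)

theory Defs
  imports
    "HOL-Library.Extended_Nonnegative_Real"
    "HOL-Computational_Algebra.Formal_Power_Series"
    "HOL-Computational_Algebra.Polynomial"
    "HOL-Computational_Algebra.Squarefree"
begin

text \<open>
  The ring \<open>K[[x,y]]\<close> is rendered as \<open>K[[x]][[y]]\<close>, i.e. the type \<open>'k fps fps\<close>; the coefficient
  of \<open>x\<^sup>i y\<^sup>j\<close> in \<open>f\<close> is \<open>fps_nth (fps_nth f j) i\<close>.
\<close>

type_synonym 'k series2 = "'k fps fps"

definition const_term :: "'k series2 \<Rightarrow> 'k" where
  "const_term f = fps_nth (fps_nth f 0) 0"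

text \<open>A curve is an ideal, so that proportional (associated) equations define the same curve.\<close>

definition curve_of :: "'k::field series2 \<Rightarrow> 'k series2 set" where
  "curve_of f = {h * f | h. True}"

definition reduced_curve :: "'k::field series2 set \<Rightarrow> bool" where
  "reduced_curve C \<longleftrightarrow> (\<exists>f. f \<noteq> 0 \<and> const_term f = 0 \<and> C = curve_of f \<and> squarefree f)"

definition branch :: "'k::field series2 set \<Rightarrow> bool" where
  "branch C \<longleftrightarrow> (\<exists>f. f \<noteq> 0 \<and> const_term f = 0 \<and> C = curve_of f \<and> irreducible f)"

definition branches :: "'k::field series2 set \<Rightarrow> 'k series2 set set" where
  "branches C = {curve_of g | f g. C = curve_of f \<and> irreducible g \<and> g dvd f}"

text \<open>
  The set \<open>\<real>\<^sub>+ \<union> {+\<infinity>}\<close> is the type \<^typ>\<open>ennreal\<close>. Only the values of \<open>\<delta>\<close> at pairs of branches are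
  constrained.
\<close>

definition log_distance :: "('k::field series2 set \<Rightarrow> 'k series2 set \<Rightarrow> ennreal) \<Rightarrow> bool" where
  "log_distance \<delta> \<longleftrightarrow>
     (\<forall>C D. branch C \<longrightarrow> branch D \<longrightarrow> (\<delta> C D = \<infinity> \<longleftrightarrow> C = D)) \<and>
     (\<forall>C D. branch C \<longrightarrow> branch D \<longrightarrow> \<delta> C D = \<delta> D C) \<and>
     (\<forall>C D E. branch C \<longrightarrow> branch D \<longrightarrow> branch E \<longrightarrow> \<delta> C D \<ge> inf (\<delta> C E) (\<delta> E D))"

text \<open>The extension of \<open>\<delta>\<close> from branches to reduced curves.\<close>

definition curve_dist ::
    "('k::field series2 set \<Rightarrow> 'k series2 set \<Rightarrow> ennreal) \<Rightarrow> 'k series2 set \<Rightarrow> 'k series2 set \<Rightarrow> ennreal"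
  where "curve_dist \<delta> C D = (INF C'\<in>branches C. INF D'\<in>branches D. \<delta> C' D')"

definition family_dist ::
    "('k::field series2 set \<Rightarrow> 'k series2 set \<Rightarrow> ennreal) \<Rightarrow> 'k series2 set \<Rightarrow> 'k series2 set set \<Rightarrow> ennreal"
  where "family_dist \<delta> C \<B> = (SUP W\<in>\<B>. curve_dist \<delta> C W)"

definition max_contact ::
    "('k::field series2 set \<Rightarrow> 'k series2 set \<Rightarrow> ennreal) \<Rightarrow> 'k series2 set \<Rightarrow> 'k series2 set set
      \<Rightarrow> 'k series2 set \<Rightarrow> bool"
  where "max_contact \<delta> C \<B> W \<longleftrightarrow> W \<in> \<B> \<and> curve_dist \<delta> C W = family_dist \<delta> C \<B>"

lemma in_curve_of_iff: "h \<in> curve_of f \<longleftrightarrow> f dvd h"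
  unfolding curve_of_def dvd_def by (simp add: mult.commute)

lemma curve_of_eq_iff: "curve_of f = curve_of g \<longleftrightarrow> f dvd g \<and> g dvd f"
proof
  assume "curve_of f = curve_of g"
  then show "f dvd g \<and> g dvd f"
    by (metis in_curve_of_iff dvd_refl)
next
  assume "f dvd g \<and> g dvd f"
  then show "curve_of f = curve_of g"
    by (intro set_eqI) (auto simp: in_curve_of_iff intro: dvd_trans)
qed

lemma branches_branch:
  assumes "branch C"
  shows "branches C = {C}"
proof -
  obtain f where f: "C = curve_of f" "irreducible f"
    using assms by (auto simp: branch_def)
  have unique: "curve_of g = C" if g: "C = curve_of f'" "irreducible g" "g dvd f'" for f' g
  proof -
    have "f' dvd f" using g(1) f(1) curve_of_eq_iff by blast
    then have "g dvd f" by (rule dvd_trans[OF g(3)])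
    then obtain a where a: "f = g * a" ..
    then have "a dvd 1"
      using irreducibleD[OF f(2) a] irreducible_not_unit[OF g(2)] by blast
    then have "f dvd g" by (simp add: a)
    then show ?thesis using f(1) curve_of_eq_iff \<open>g dvd f\<close> by blast
  qed
  have "C \<in> branches C"
    unfolding branches_def mem_Collect_eq using f dvd_refl[of f] by metis
  moreover have "D = C" if D: "D \<in> branches C" for D
  proof -
    obtain f' g where "D = curve_of g" "C = curve_of f'" "irreducible g" "g dvd f'"
      using D unfolding branches_def mem_Collect_eq by metis
    then show ?thesis using unique by metis
  qed
  ultimately show ?thesis by auto
qed

lemma curve_dist_branch:
  assumes "branch C" "branch D"
  shows "curve_dist \<delta> C D = \<delta> C D"
  using assms by (simp add: curve_dist_def branches_branch)

lemma const_term_unit: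
  assumes "const_term f \<noteq> 0"
  shows "f dvd (1 :: 'k::field series2)"
proof -
  define u where "u = fps_nth f 0"
  have u: "fps_nth u 0 \<noteq> 0" using assms by (simp add: u_def const_term_def)
  then have "fps_nth f 0 * inverse u = 1"
    by (simp add: u_def[symmetric] inverse_mult_eq_1')
  then have "f * fps_right_inverse f (inverse u) = 1" by (rule fps_right_inverse)
  then show ?thesis by (metis dvd_triv_left)
qed

lemma branches_imp_branch:
  assumes "D \<in> branches C"
  shows "branch D"
proof -
  obtain g where g: "D = curve_of g" "irreducible g"
    using assms by (auto simp: branches_def)
  moreover have "const_term g = 0"
    using const_term_unit irreducible_not_unit[OF g(2)] by blast
  ultimately show ?thesis unfolding branch_def by (metis not_irreducible_zero)
qed

end

theory Submission
  imports Defs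
begin

text \<open>
  Everything follows from the strong triangle inequality for \<open>\<delta>\<close> on branches. Let \<open>R\<close> be the
  right-hand side of the formula (\<open>contact_bound\<close>).

  No branch \<open>W\<close> of \<open>\<B>\<close> does better than \<open>R\<close>: each branch of \<open>C\<close> is at least as close to \<open>W\<close>
  as \<open>C\<close> is, hence, going through \<open>W\<close>, any two branches of \<open>C\<close> are at least that close to each
  other (\<open>family_dist_upper\<close>).

  Conversely, \<open>R\<close> is reached by any \<open>W\<close> that has maximal contact with a single branch \<open>D\<close> of \<open>C\<close>:
  such a \<open>W\<close> is at least \<open>R\<close>-close to \<open>D\<close>, and \<open>D\<close> is at least \<open>R\<close>-close to every branch of
  \<open>C\<close>, so going through \<open>D\<close> shows that \<open>W\<close> is at least \<open>R\<close>-close to all of them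
  (\<open>max_contact_lower\<close>). Such a \<open>W\<close> exists because the suprema over \<open>\<B>\<close> are attained for
  branches, and \<open>D\<close> is arbitrary, so every index can serve as \<open>i\<^sub>0\<close>.
\<close>

lemma log_distance_sym:
  assumes "log_distance \<delta>" "branch C" "branch D"
  shows "\<delta> C D = \<delta> D C"
  using assms unfolding log_distance_def by blast

lemma log_distance_triangle:
  assumes "log_distance \<delta>" "branch C" "branch D" "branch E"
  shows "inf (\<delta> C E) (\<delta> E D) \<le> \<delta> C D"
  using assms unfolding log_distance_def by blast

lemma curve_dist_branch_right:
  assumes "branch W"
  shows "curve_dist \<delta> C W = (INF D\<in>branches C. \<delta> D W)"
  using assms by (simp add: curve_dist_def branches_branch)

definition contact_bound ::
    "('k::field series2 set \<Rightarrow> 'k series2 set \<Rightarrow> ennreal) \<Rightarrow> 'k series2 set \<Rightarrow> 'k series2 set set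
      \<Rightarrow> ennreal"
  where "contact_bound \<delta> C \<B> =
    inf (INF D\<in>branches C. family_dist \<delta> D \<B>) (INF D\<in>branches C. INF E\<in>branches C. \<delta> D E)"

text \<open>
  If \<open>W\<close> is close to \<open>C\<close>, then the strong triangle inequality through \<open>W\<close> forces the branches
  of \<open>C\<close> to be close to each other.
\<close>

lemma family_dist_upper:
  assumes \<delta>: "log_distance \<delta>" and \<B>: "\<And>W. W \<in> \<B> \<Longrightarrow> branch W"
  shows "family_dist \<delta> C \<B> \<le> contact_bound \<delta> C \<B>"
  unfolding family_dist_def[of \<delta> C]
proof (rule SUP_least)
  fix W assume W: "W \<in> \<B>"
  have le: "curve_dist \<delta> C W \<le> \<delta> D W" if "D \<in> branches C" for D
    unfolding curve_dist_branch_right[OF \<B>[OF W]] using that by (rule INF_lower)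
  have "curve_dist \<delta> C W \<le> family_dist \<delta> D \<B>" if D: "D \<in> branches C" for D
  proof -
    have "\<delta> D W = curve_dist \<delta> D W"
      using curve_dist_branch[OF branches_imp_branch[OF D] \<B>[OF W]] by simp
    also have "\<dots> \<le> family_dist \<delta> D \<B>"
      unfolding family_dist_def by (rule SUP_upper[OF W])
    finally show ?thesis using le[OF D] by (rule order_trans[rotated])
  qed
  moreover have "curve_dist \<delta> C W \<le> \<delta> D E" if D: "D \<in> branches C" and E: "E \<in> branches C" for D E
  proof -
    have br: "branch D" "branch E" "branch W"
      using D E W by (auto intro: branches_imp_branch \<B>)
    have "curve_dist \<delta> C W \<le> inf (\<delta> D W) (\<delta> W E)"
      using le[OF D] le[OF E] log_distance_sym[OF \<delta> br(2,3)] by simp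
    also have "\<dots> \<le> \<delta> D E" by (rule log_distance_triangle[OF \<delta> br])
    finally show ?thesis .
  qed
  ultimately show "curve_dist \<delta> C W \<le> contact_bound \<delta> C \<B>"
    unfolding contact_bound_def by (intro le_infI INF_greatest)
qed

text \<open>
  Any branch \<open>E\<close> of \<open>C\<close> is compared with \<open>W\<close> through \<open>D\<close>: the distance from \<open>E\<close> to \<open>D\<close> is
  controlled by the second infimum of the bound, the one from \<open>D\<close> to \<open>W\<close> by the first.
\<close>

lemma max_contact_lower:
  assumes \<delta>: "log_distance \<delta>" and D: "D \<in> branches C" and "branch W"
    and contact: "max_contact \<delta> D \<B> W"
  shows "contact_bound \<delta> C \<B> \<le> curve_dist \<delta> C W"
  unfolding curve_dist_branch_right[OF \<open>branch W\<close>]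
proof (rule INF_greatest)
  fix E assume E: "E \<in> branches C"
  have br: "branch E" "branch W" "branch D"
    using D E \<open>branch W\<close> by (auto intro: branches_imp_branch)
  have "family_dist \<delta> D \<B> = \<delta> D W"
    using contact curve_dist_branch[OF br(3,2)] by (simp add: max_contact_def)
  then have "contact_bound \<delta> C \<B> \<le> \<delta> D W"
    unfolding contact_bound_def by (metis D INF_lower inf.coboundedI1)
  moreover have "contact_bound \<delta> C \<B> \<le> \<delta> E D"
    unfolding contact_bound_def by (intro le_infI2 INF_lower2[OF E] INF_lower D)
  ultimately have "contact_bound \<delta> C \<B> \<le> inf (\<delta> E D) (\<delta> D W)" by simp
  also have "\<dots> \<le> \<delta> E W" by (rule log_distance_triangle[OF \<delta> br])
  finally show "contact_bound \<delta> C \<B> \<le> \<delta> E W" .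
qed

lemma max_contact_with_branch:
  assumes \<delta>: "log_distance \<delta>" and D: "D \<in> branches C"
    and \<B>: "\<And>W. W \<in> \<B> \<Longrightarrow> branch W" and contact: "max_contact \<delta> D \<B> W"
  shows "family_dist \<delta> C \<B> = contact_bound \<delta> C \<B>" and "max_contact \<delta> C \<B> W"
proof -
  have W: "W \<in> \<B>" using contact by (simp add: max_contact_def)
  have "contact_bound \<delta> C \<B> \<le> curve_dist \<delta> C W"
    by (rule max_contact_lower[OF \<delta> D \<B>[OF W] contact])
  moreover have "curve_dist \<delta> C W \<le> family_dist \<delta> C \<B>"
    unfolding family_dist_def by (rule SUP_upper[OF W])
  moreover have "family_dist \<delta> C \<B> \<le> contact_bound \<delta> C \<B>"
    by (rule family_dist_upper[OF \<delta> \<B>])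
  ultimately show "family_dist \<delta> C \<B> = contact_bound \<delta> C \<B>" and "max_contact \<delta> C \<B> W"
    using W by (auto simp: max_contact_def)
qed

theorem theorem2p3:
  fixes \<delta> :: "'k::alg_closed_field series2 set \<Rightarrow> 'k series2 set \<Rightarrow> ennreal"
    and C :: "'k series2 set"
    and Cs :: "nat \<Rightarrow> 'k series2 set"
    and r :: nat
    and \<B> :: "'k series2 set set"
  assumes "log_distance \<delta>"
    and "reduced_curve C"
    and "r > 1"
    and "bij_betw Cs {1..r} (branches C)"
    and "\<B> \<noteq> {}"
    and "\<And>W. W \<in> \<B> \<Longrightarrow> branch W"
    and "\<And>D. branch D \<Longrightarrow> \<exists>W\<^sub>0\<in>\<B>. family_dist \<delta> D \<B> = \<delta> D W\<^sub>0"
  shows "family_dist \<delta> C \<B> =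
           inf (INF i\<in>{1..r}. family_dist \<delta> (Cs i) \<B>)
               (INF i\<in>{1..r}. INF j\<in>{1..r}. \<delta> (Cs i) (Cs j))
         \<and> (\<exists>i\<^sub>0\<in>{1..r}. \<forall>W\<in>\<B>.
              max_contact \<delta> (Cs i\<^sub>0) \<B> W \<longrightarrow> max_contact \<delta> C \<B> W)"
proof -
  have im: "branches C = Cs ` {1..r}"
    using assms(4) by (simp add: bij_betw_def)
  have bound: "contact_bound \<delta> C \<B> =
      inf (INF i\<in>{1..r}. family_dist \<delta> (Cs i) \<B>)
          (INF i\<in>{1..r}. INF j\<in>{1..r}. \<delta> (Cs i) (Cs j))"
    by (simp add: contact_bound_def im image_image)
  have one: "1 \<in> {1..r}" using assms(3) by simp
  then have C1: "Cs 1 \<in> branches C" by (simp add: im)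
  then have br: "branch (Cs 1)" by (rule branches_imp_branch)
  obtain W\<^sub>0 where "W\<^sub>0 \<in> \<B>" "family_dist \<delta> (Cs 1) \<B> = \<delta> (Cs 1) W\<^sub>0"
    using assms(7)[OF br] by blast
  then have "max_contact \<delta> (Cs 1) \<B> W\<^sub>0"
    using curve_dist_branch[OF br assms(6)] by (simp add: max_contact_def)
  then have "family_dist \<delta> C \<B> = contact_bound \<delta> C \<B>"
    using max_contact_with_branch(1)[OF assms(1) C1 assms(6)] by blast
  moreover have "max_contact \<delta> C \<B> W" if "max_contact \<delta> (Cs 1) \<B> W" for W
    using max_contact_with_branch(2)[OF assms(1) C1 assms(6) that] .
  ultimately show ?thesis unfolding bound[symmetric] using one by blast
qed

end
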